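(* Let $(H;\langle\cdot,\cdot\rangle)$ be a real or complex inner product space over $\mathbb{K}$ ($\mathbb{K}=\mathbb{R}$ or $\mathbb{K}=\mathbb{C}$), let $\gamma,\Gamma\in\mathbb{K}$ with $\Gamma\neq-\gamma$, and let $x,y_j\in H$, $j\in\{1,\dots,n\}$, be such that $$(\operatorname{Re}\Gamma-\operatorname{Re}\langle x,y_j\rangle)(\operatorname{Re}\langle x,y_j\rangle-\operatorname{Re}\gamma)+(\operatorname{Im}\Gamma-\operatorname{Im}\langle x,y_j\rangle)(\operatorname{Im}\langle x,y_j\rangle-\operatorname{Im}\gamma)\geq 0$$ or, equivalently, $$\left|\langle x,y_j\rangle-\frac{\gamma+\Gamma}{2}\right|\leq\frac12|\Gamma-\gamma|$$ for each $j\in\{1,\dots,n\}$. Then $$\left(\sum_{j=1}^{n}|\langle x,y_j\rangle|^2\right)^{\frac12}\leq\frac{1}{\sqrt n}\,\|x\|\,\left\|\sum_{j=1}^{n}y_j\right\|+\frac14\sqrt n\cdot\frac{|\Gamma-\gamma|^2}{|\Gamma+\gamma|}.$$ Moreover, for $x\neq 0$, equality holds in this last inequality if and only if $$\left|\langle x,y_j\rangle-\frac{\gamma+\Gamma}{2}\right|=\frac12|\Gamma-\gamma|\quad\text{for each } j\in\{1,\dots,n\}$$ and $$\frac1n\sum_{j=1}^{n}y_j=\frac14\cdot\frac{|\Gamma|^2+6\operatorname{Re}(\Gamma\bar\gamma)+|\gamma|^2}{(\Gamma+\gamma)\|x\|^2}\cdot x.$$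
   Context: $n\geq 1$ is an integer. The inner product $\langle\cdot,\cdot\rangle$ is linear in the first argument and conjugate-linear in the second, and $\|x\|=\langle x,x\rangle^{1/2}$. $\operatorname{Re}$, $\operatorname{Im}$ and the bar denote real part, imaginary part and complex conjugation (when $\mathbb{K}=\mathbb{R}$, imaginary parts are $0$ and conjugation is trivial).
   Formalization: The equality characterization has the extra condition |Γ|²+6Re(Γγ̄)+|γ|² ≥ 0 among the equivalent conditions; without it the "if" part fails, e.g. n=8, x=1, γ=−1, Γ=5, y_1=5, y_2=…=y_8=−1 in ℝ. *)

theory Defs
  imports "HOL-Analysis.Analysis"
begin

text \<open>
  Real inner product spaces are the library class \<open>real_inner\<close>. In the complex case the
  inner product is linear in the first argument and conjugate-linear in the second.
\<close>

locale complex_inner_product_space = vector_space scale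
  for scale :: "complex \<Rightarrow> 'h::ab_group_add \<Rightarrow> 'h" +
  fixes ip :: "'h \<Rightarrow> 'h \<Rightarrow> complex"
  assumes ip_add_left: "ip (x + y) z = ip x z + ip y z"
    and ip_scale_left: "ip (scale a x) y = a * ip x y"
    and ip_commute: "ip y x = cnj (ip x y)"
    and ip_ge_zero: "0 \<le> Re (ip x x)"
    and ip_eq_zero_iff: "ip x x = 0 \<longleftrightarrow> x = 0"

text \<open>\<open>ip x x\<close> is real by conjugate symmetry, so taking the real part loses nothing.\<close>

definition ip_norm :: "('h \<Rightarrow> 'h \<Rightarrow> complex) \<Rightarrow> 'h \<Rightarrow> real" where
  "ip_norm ip x = sqrt (Re (ip x x))"

text \<open>
  The condition \<open>\<bar>G\<bar>\<^sup>2 + 6 * Re (G * cnj g) + \<bar>g\<bar>\<^sup>2 \<ge> 0\<close> has to be part of the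
  characterization of equality: without it, the boundary condition and the formula for the mean
  of the \<open>y j\<close> do not imply equality, already over the reals.
\<close>

lemma equality_characterization_needs_sign_condition:
  fixes x g G :: real and y :: "nat \<Rightarrow> real" and n :: nat
  defines "n \<equiv> 8" and "x \<equiv> 1" and "g \<equiv> -1" and "G \<equiv> 5"
    and "y \<equiv> (\<lambda>j. if j = 1 then 5 else -1)"
  shows "G \<noteq> - g" "x \<noteq> 0"
    and "\<forall>j\<in>{1..n}. \<bar>inner x (y j) - (g + G) / 2\<bar> = 1 / 2 * \<bar>G - g\<bar>"
    and "(1 / real n) *\<^sub>R (\<Sum>j=1..n. y j) =
      (1 / 4 * ((\<bar>G\<bar>\<^sup>2 + 6 * (G * g) + \<bar>g\<bar>\<^sup>2) / ((G + g) * (norm x)\<^sup>2))) *\<^sub>R x"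
    and "sqrt (\<Sum>j=1..n. \<bar>inner x (y j)\<bar>\<^sup>2) \<noteq>
      1 / sqrt (real n) * norm x * norm (\<Sum>j=1..n. y j)
        + 1 / 4 * sqrt (real n) * (\<bar>G - g\<bar>\<^sup>2 / \<bar>G + g\<bar>)"
proof -
  have set8: "{1..8::nat} = {1,2,3,4,5,6,7,8}"
    by auto
  have sum: "(\<Sum>j=1..n. y j) = -2" "(\<Sum>j=1..n. \<bar>inner x (y j)\<bar>\<^sup>2) = 32"
    unfolding n_def set8 x_def y_def by simp_all
  show "G \<noteq> - g" "x \<noteq> 0" by (simp_all add: G_def g_def x_def)
  show "\<forall>j\<in>{1..n}. \<bar>inner x (y j) - (g + G) / 2\<bar> = 1 / 2 * \<bar>G - g\<bar>"
    by (simp add: G_def g_def x_def y_def)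
  show "(1 / real n) *\<^sub>R (\<Sum>j=1..n. y j) =
      (1 / 4 * ((\<bar>G\<bar>\<^sup>2 + 6 * (G * g) + \<bar>g\<bar>\<^sup>2) / ((G + g) * (norm x)\<^sup>2))) *\<^sub>R x"
    unfolding sum by (simp add: G_def g_def x_def n_def)
  have s: "sqrt 32 = 2 * sqrt (8::real)"
    using real_sqrt_mult[of 4 8] by simp
  have "9 / 4 * sqrt 8 = 1 / 4 * sqrt (8::real) * 9" by simp
  moreover have "1 / sqrt 8 * 2 > (0::real)" by simp
  moreover have "sqrt 8 > (0::real)" by simp
  ultimately have "sqrt 32 < 1 / sqrt 8 * 2 + 1 / 4 * sqrt (8::real) * 9"
    unfolding s by linarith
  then show "sqrt (\<Sum>j=1..n. \<bar>inner x (y j)\<bar>\<^sup>2) \<noteq>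
      1 / sqrt (real n) * norm x * norm (\<Sum>j=1..n. y j)
        + 1 / 4 * sqrt (real n) * (\<bar>G - g\<bar>\<^sup>2 / \<bar>G + g\<bar>)"
    unfolding sum by (simp add: G_def g_def x_def n_def)
qed

end

theory Submission
  imports Defs
begin

text \<open>
  Write \<open>m\<close> for the centre \<open>(\<gamma> + \<Gamma>) / 2\<close>, \<open>r\<close> for the radius \<open>\<bar>\<Gamma> - \<gamma>\<bar> / 2\<close>, and \<open>z j\<close> for the
  scalars \<open>\<langle>x, y j\<rangle>\<close>. Both the inequality and its equality case are read off from one identity,
  valid for every real \<open>P\<close>: with \<open>S = (\<Sum>j. \<bar>z j\<bar>\<^sup>2)\<close> and \<open>Z = (\<Sum>j. z j)\<close>, the right-hand side
  minus the left-hand side of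
  \<open>sqrt S \<le> P / sqrt n + sqrt n * r\<^sup>2 / (2 * \<bar>m\<bar>)\<close>, multiplied by \<open>2 * sqrt n * \<bar>m\<bar>\<close>, is
  \<open>(sqrt S - sqrt n * \<bar>m\<bar>)\<^sup>2 + (\<Sum>j. r\<^sup>2 - \<bar>z j - m\<bar>\<^sup>2) + 2 * (\<bar>m\<bar> * P - Re (Z * cnj m))\<close>.
  The second term is nonnegative because the \<open>z j\<close> lie in the disc, the third one because
  \<open>\<bar>Z\<bar> \<le> P\<close> for \<open>P = \<parallel>x\<parallel> * \<parallel>\<Sum>j. y j\<parallel>\<close>, by the Cauchy-Schwarz inequality.

  Equality means that all three terms vanish. The second one says that every \<open>z j\<close> is on the
  boundary circle; given this, the other two determine \<open>Z\<close> as a real multiple of \<open>m\<close> and force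
  \<open>P = \<bar>Z\<bar>\<close>. The latter is equality in the Cauchy-Schwarz inequality, so \<open>\<Sum>j. y j\<close> is a multiple
  of \<open>x\<close>, and the value of \<open>Z\<close> fixes the factor. Conversely, the formula for the mean gives
  \<open>P = \<bar>Z\<bar>\<close>, but \<open>Re (Z * cnj m) = \<bar>m\<bar> * P\<close> only if the real multiple of \<open>m\<close> is nonnegative:
  this is where the sign condition on \<open>\<bar>\<Gamma>\<bar>\<^sup>2 + 6 * Re (\<Gamma> * cnj \<gamma>) + \<bar>\<gamma>\<bar>\<^sup>2\<close> comes from.

  The scalar argument only uses the real inner product \<open>Re (a * cnj b)\<close> of scalars. It is
  therefore carried out in an arbitrary real inner product space, which covers \<open>\<real>\<close> and \<open>\<complex>\<close> at once
  (lemmas \<open>sqrt_sum_norm_le\<close> and \<open>sqrt_sum_norm_eq_iff\<close>); only the Cauchy-Schwarz step differs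
  between the two fields.
\<close>

section \<open>Families of points in a ball\<close>

lemma dist_midpoint_power2:
  fixes a b z :: "'a::real_inner"
  shows "(norm (z - (1/2) *\<^sub>R (a + b)))\<^sup>2 = (1/2 * norm (b - a))\<^sup>2 - inner (b - z) (z - a)"
  by (simp add: power2_norm_eq_inner power_divide inner_diff_left inner_diff_right
      inner_add_left inner_add_right inner_commute field_simps)

lemma in_ball_of_diameter_iff:
  fixes a b z :: "'a::real_inner"
  shows "0 \<le> inner (b - z) (z - a) \<longleftrightarrow> norm (z - (1/2) *\<^sub>R (a + b)) \<le> 1/2 * norm (b - a)"
proof -
  have "norm (z - (1/2) *\<^sub>R (a + b)) \<le> 1/2 * norm (b - a)
      \<longleftrightarrow> (norm (z - (1/2) *\<^sub>R (a + b)))\<^sup>2 \<le> (1/2 * norm (b - a))\<^sup>2"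
    by (rule power_mono_iff[symmetric]) simp_all
  then show ?thesis
    by (simp add: dist_midpoint_power2)
qed

lemma norm_diff_scaleR_power2:
  fixes u v :: "'a::real_inner"
  shows "(norm (u - t *\<^sub>R v))\<^sup>2 = (norm u)\<^sup>2 - 2 * t * inner v u + t\<^sup>2 * (norm v)\<^sup>2"
  by (simp add: power2_norm_eq_inner inner_diff_left inner_diff_right inner_commute
      power2_eq_square[of t] algebra_simps)

lemma sum_dist_power2:
  fixes z :: "'i \<Rightarrow> 'a::real_inner"
  shows "(\<Sum>j\<in>A. (norm (z j - m))\<^sup>2)
    = (\<Sum>j\<in>A. (norm (z j))\<^sup>2) - 2 * inner m (\<Sum>j\<in>A. z j) + real (card A) * (norm m)\<^sup>2"
proof -
  have "(norm (z j - m))\<^sup>2 = (norm (z j))\<^sup>2 - 2 * inner m (z j) + (norm m)\<^sup>2" for j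
    using norm_diff_scaleR_power2[of "z j" 1 m] by simp
  then show ?thesis
    by (simp add: sum.distrib sum_subtractf sum_distrib_left inner_sum_right)
qed

text \<open>
  The identity that carries the theorem. On the right, the first term is the defect in the
  estimate of the geometric by the arithmetic mean of \<open>S\<close> and \<open>n * \<bar>m\<bar>\<^sup>2\<close>.
\<close>

lemma slack_identity:
  fixes z :: "'i \<Rightarrow> 'a::real_inner"
  assumes "finite A" "A \<noteq> {}" "m \<noteq> 0"
  defines "S \<equiv> \<Sum>j\<in>A. (norm (z j))\<^sup>2" and "n \<equiv> real (card A)"
  shows "2 * sqrt n * norm m * (1 / sqrt n * P + sqrt n * (r\<^sup>2 / (2 * norm m)) - sqrt S)
    = (sqrt S - sqrt n * norm m)\<^sup>2 + (\<Sum>j\<in>A. r\<^sup>2 - (norm (z j - m))\<^sup>2)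
      + 2 * (norm m * P - inner m (\<Sum>j\<in>A. z j))"
proof -
  have n: "n > 0" using assms by (simp add: n_def card_gt_0_iff)
  have S: "S \<ge> 0" by (simp add: S_def sum_nonneg)
  have nn: "sqrt n * sqrt n = n" and ss: "(sqrt S)\<^sup>2 = S" using n S by simp_all
  have "2 * sqrt n * norm m * (1 / sqrt n * P + sqrt n * (r\<^sup>2 / (2 * norm m)) - sqrt S)
      = 2 * norm m * P + (sqrt n * sqrt n) * r\<^sup>2 - 2 * sqrt n * norm m * sqrt S"
    using n \<open>m \<noteq> 0\<close> by (simp add: field_simps)
  also have "\<dots> = (sqrt S - sqrt n * norm m)\<^sup>2 + (n * r\<^sup>2 - (S - 2 * inner m (\<Sum>j\<in>A. z j) + n * (norm m)\<^sup>2))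
      + 2 * (norm m * P - inner m (\<Sum>j\<in>A. z j))"
    using n by (simp add: power2_diff power_mult_distrib ss nn algebra_simps)
  finally show ?thesis
    by (simp add: sum_subtractf sum_dist_power2 S_def n_def)
qed

text \<open>
  Each of the three terms of \<open>slack_identity\<close> is nonnegative here, so equality holds exactly when all
  of them vanish. Since \<open>P\<close> bounds a norm, the condition on \<open>P\<close> also makes the factor
  in front of \<open>m\<close> nonnegative.
\<close>

lemma sqrt_sum_norm_le_ball:
  fixes z :: "'i \<Rightarrow> 'a::real_inner"
  assumes A: "finite A" "A \<noteq> {}" and m: "m \<noteq> 0"
    and ball: "\<forall>j\<in>A. norm (z j - m) \<le> r"
    and P: "norm (\<Sum>j\<in>A. z j) \<le> P"
  defines "n \<equiv> real (card A)"
  shows "sqrt (\<Sum>j\<in>A. (norm (z j))\<^sup>2) \<le> 1 / sqrt n * P + sqrt n * (r\<^sup>2 / (2 * norm m))"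
    and "sqrt (\<Sum>j\<in>A. (norm (z j))\<^sup>2) = 1 / sqrt n * P + sqrt n * (r\<^sup>2 / (2 * norm m)) \<longleftrightarrow>
      (\<forall>j\<in>A. norm (z j - m) = r) \<and>
      (\<Sum>j\<in>A. z j) = (n * (2 * (norm m)\<^sup>2 - r\<^sup>2) / (2 * (norm m)\<^sup>2)) *\<^sub>R m \<and>
      P = n * (2 * (norm m)\<^sup>2 - r\<^sup>2) / (2 * (norm m)\<^sup>2) * norm m"
proof -
  define S where "S = (\<Sum>j\<in>A. (norm (z j))\<^sup>2)"
  define Z where "Z = (\<Sum>j\<in>A. z j)"
  define q where "q = n * (2 * (norm m)\<^sup>2 - r\<^sup>2) / (2 * (norm m)\<^sup>2)"
  define rhs where "rhs = 1 / sqrt n * P + sqrt n * (r\<^sup>2 / (2 * norm m))"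
  have n: "n > 0" using A by (simp add: n_def card_gt_0_iff)
  have S0: "S \<ge> 0" by (simp add: S_def sum_nonneg)
  have c: "2 * sqrt n * norm m > 0" using n m by simp
  have r: "r \<ge> 0" using ball A by (meson all_not_in_conv norm_ge_zero order_trans)
  have t: "0 \<le> r\<^sup>2 - (norm (z j - m))\<^sup>2" if "j \<in> A" for j
    using ball that by (simp add: power_mono)
  have t2: "0 \<le> (\<Sum>j\<in>A. r\<^sup>2 - (norm (z j - m))\<^sup>2)" using t by (rule sum_nonneg)
  have "inner m Z \<le> norm m * norm Z" by (rule norm_cauchy_schwarz)
  also have "\<dots> \<le> norm m * P" using P by (simp add: Z_def mult_left_mono)
  finally have t3: "0 \<le> norm m * P - inner m Z" by simp
  have slack: "2 * sqrt n * norm m * (rhs - sqrt S)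
      = (sqrt S - sqrt n * norm m)\<^sup>2 + (\<Sum>j\<in>A. r\<^sup>2 - (norm (z j - m))\<^sup>2) + 2 * (norm m * P - inner m Z)"
    using slack_identity[OF A m, where z = z and P = P and r = r] by (simp only: rhs_def S_def Z_def n_def)
  have "0 \<le> 2 * sqrt n * norm m * (rhs - sqrt S)"
    unfolding slack using t2 t3 by simp
  with c have "sqrt S \<le> rhs" by (simp add: zero_le_mult_iff)
  then show "sqrt (\<Sum>j\<in>A. (norm (z j))\<^sup>2) \<le> 1 / sqrt n * P + sqrt n * (r\<^sup>2 / (2 * norm m))"
    by (simp add: S_def rhs_def)
  have "sqrt S = rhs \<longleftrightarrow> 2 * sqrt n * norm m * (rhs - sqrt S) = 0" using c by auto
  also have "\<dots> \<longleftrightarrow> (sqrt S - sqrt n * norm m)\<^sup>2 = 0 \<and> (\<Sum>j\<in>A. r\<^sup>2 - (norm (z j - m))\<^sup>2) = 0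
      \<and> norm m * P - inner m Z = 0"
  proof -
    have "a + b + 2 * c = 0 \<longleftrightarrow> a = 0 \<and> b = 0 \<and> c = 0" if "0 \<le> a" "0 \<le> b" "0 \<le> c" for a b c :: real
      using that by auto
    from this[OF zero_le_power2 t2 t3] show ?thesis unfolding slack .
  qed
  also have "(sqrt S - sqrt n * norm m)\<^sup>2 = 0 \<longleftrightarrow> S = n * (norm m)\<^sup>2"
  proof -
    have "sqrt n * norm m = sqrt (n * (norm m)\<^sup>2)" by (simp add: real_sqrt_mult)
    then show ?thesis by simp
  qed
  also have "(\<Sum>j\<in>A. r\<^sup>2 - (norm (z j - m))\<^sup>2) = 0 \<longleftrightarrow> (\<forall>j\<in>A. norm (z j - m) = r)"
  proof -
    have "(\<Sum>j\<in>A. r\<^sup>2 - (norm (z j - m))\<^sup>2) = 0 \<longleftrightarrow> (\<forall>j\<in>A. r\<^sup>2 - (norm (z j - m))\<^sup>2 = 0)"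
      using A(1) t by (rule sum_nonneg_eq_0_iff)
    also have "\<dots> \<longleftrightarrow> (\<forall>j\<in>A. norm (z j - m) = r)"
      using r by (auto simp: power2_eq_iff_nonneg)
    finally show ?thesis .
  qed
  finally have iff: "sqrt S = rhs \<longleftrightarrow>
      S = n * (norm m)\<^sup>2 \<and> (\<forall>j\<in>A. norm (z j - m) = r) \<and> norm m * P - inner m Z = 0" .
  have q: "2 * q * (norm m)\<^sup>2 = n * (2 * (norm m)\<^sup>2 - r\<^sup>2)"
    using m by (simp add: q_def)
  \<comment> \<open>On the boundary, the distances to \<open>m\<close> tie \<open>S\<close> to the projection of \<open>Z\<close> on \<open>m\<close>.\<close>
  have bd: "S - 2 * inner m Z + n * (norm m)\<^sup>2 = n * r\<^sup>2" if "\<forall>j\<in>A. norm (z j - m) = r"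
    using sum_dist_power2[of z m A] that by (simp add: S_def Z_def n_def)
  have "sqrt S = rhs \<longleftrightarrow> (\<forall>j\<in>A. norm (z j - m) = r) \<and> Z = q *\<^sub>R m \<and> P = q * norm m"
  proof
    assume "sqrt S = rhs"
    then have S: "S = n * (norm m)\<^sup>2" and b: "\<forall>j\<in>A. norm (z j - m) = r"
      and mP: "norm m * P = inner m Z"
      using iff by auto
    have mZ: "inner m Z = q * (norm m)\<^sup>2"
      using bd[OF b] q S by (simp add: algebra_simps)
    then have Pq: "P = q * norm m"
      using mP m by (simp add: power2_eq_square)
    \<comment> \<open>\<open>Z\<close> has the same projection on \<open>m\<close> as \<open>q *\<^sub>R m\<close> and is not longer, so they agree.\<close>
    have "(norm (Z - q *\<^sub>R m))\<^sup>2 = (norm Z)\<^sup>2 - 2 * q * inner m Z + q\<^sup>2 * (norm m)\<^sup>2"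
      by (simp add: norm_diff_scaleR_power2)
    also have "\<dots> = (norm Z)\<^sup>2 - P\<^sup>2"
      by (simp add: mZ Pq power2_eq_square algebra_simps)
    also have "\<dots> \<le> 0"
      using P by (simp add: Z_def power_mono)
    finally have "Z = q *\<^sub>R m" by simp
    with b Pq show "(\<forall>j\<in>A. norm (z j - m) = r) \<and> Z = q *\<^sub>R m \<and> P = q * norm m" by simp
  next
    assume R: "(\<forall>j\<in>A. norm (z j - m) = r) \<and> Z = q *\<^sub>R m \<and> P = q * norm m"
    then have mZ: "inner m Z = q * (norm m)\<^sup>2" by (simp add: power2_norm_eq_inner)
    have "S = n * (norm m)\<^sup>2"
      using bd[OF R[THEN conjunct1]] q mZ by (simp add: algebra_simps)
    moreover have "norm m * P - inner m Z = 0"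
      using mZ R[THEN conjunct2, THEN conjunct2] by (simp add: power2_eq_square)
    ultimately show "sqrt S = rhs" using iff R by blast
  qed
  then show "sqrt (\<Sum>j\<in>A. (norm (z j))\<^sup>2) = 1 / sqrt n * P + sqrt n * (r\<^sup>2 / (2 * norm m)) \<longleftrightarrow>
      (\<forall>j\<in>A. norm (z j - m) = r) \<and>
      (\<Sum>j\<in>A. z j) = (n * (2 * (norm m)\<^sup>2 - r\<^sup>2) / (2 * (norm m)\<^sup>2)) *\<^sub>R m \<and>
      P = n * (2 * (norm m)\<^sup>2 - r\<^sup>2) / (2 * (norm m)\<^sup>2) * norm m"
    by (simp only: S_def Z_def q_def rhs_def)
qed

text \<open>
  The previous lemma for the ball with diameter from \<open>a\<close> to \<open>b\<close>. The expression
  \<open>\<bar>b\<bar>\<^sup>2 + 6 * inner b a + \<bar>a\<bar>\<^sup>2\<close> is \<open>4 * (2 * \<bar>m\<bar>\<^sup>2 - r\<^sup>2)\<close> in terms of centre and radius.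
\<close>

lemma
  fixes z :: "'i \<Rightarrow> 'a::real_inner"
  assumes A: "finite A" "A \<noteq> {}" and ba: "b \<noteq> - a"
    and ball: "\<forall>j\<in>A. norm (z j - (1/2) *\<^sub>R (a + b)) \<le> 1/2 * norm (b - a)"
    and P: "norm (\<Sum>j\<in>A. z j) \<le> P"
  defines "n \<equiv> real (card A)"
    and "w \<equiv> (real (card A) * (((norm b)\<^sup>2 + 6 * inner b a + (norm a)\<^sup>2) / (4 * (norm (b + a))\<^sup>2))) *\<^sub>R (b + a)"
  shows sqrt_sum_norm_le: "sqrt (\<Sum>j\<in>A. (norm (z j))\<^sup>2)
      \<le> 1 / sqrt n * P + 1/4 * sqrt n * ((norm (b - a))\<^sup>2 / norm (b + a))"
    and sqrt_sum_norm_eq_iff: "sqrt (\<Sum>j\<in>A. (norm (z j))\<^sup>2)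
        = 1 / sqrt n * P + 1/4 * sqrt n * ((norm (b - a))\<^sup>2 / norm (b + a)) \<longleftrightarrow>
      (\<forall>j\<in>A. norm (z j - (1/2) *\<^sub>R (a + b)) = 1/2 * norm (b - a)) \<and>
      0 \<le> (norm b)\<^sup>2 + 6 * inner b a + (norm a)\<^sup>2 \<and> (\<Sum>j\<in>A. z j) = w \<and> P = norm w"
proof -
  define m where "m = (1/2) *\<^sub>R (a + b)"
  define r where "r = 1/2 * norm (b - a)"
  define K where "K = (norm b)\<^sup>2 + 6 * inner b a + (norm a)\<^sup>2"
  define N where "N = norm (b + a)"
  have N: "N > 0" using ba by (simp add: N_def eq_neg_iff_add_eq_0)
  have n: "n > 0" using A by (simp add: n_def card_gt_0_iff)
  have m: "norm m = N / 2" by (simp add: m_def N_def add.commute)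
  have m0: "m \<noteq> 0" using N m by auto
  have r2: "r\<^sup>2 = (norm (b - a))\<^sup>2 / 4" by (simp add: r_def power_mult_distrib power2_eq_square)
  have K: "K = 4 * (2 * (norm m)\<^sup>2 - r\<^sup>2)"
    unfolding m r2 K_def N_def
    by (simp add: power_divide power2_norm_eq_inner inner_diff_left inner_diff_right
      inner_add_left inner_add_right inner_commute field_simps)
  have rad: "sqrt n * (r\<^sup>2 / (2 * norm m)) = 1/4 * sqrt n * ((norm (b - a))\<^sup>2 / norm (b + a))"
    by (simp add: r2 m N_def)
  define q where "q = n * (K / (4 * N\<^sup>2))"
  have q2: "n * (2 * (norm m)\<^sup>2 - r\<^sup>2) / (2 * (norm m)\<^sup>2) = 2 * q"
    using N unfolding q_def K m by (simp add: field_simps)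
  have w: "w = q *\<^sub>R (b + a)"
    by (simp add: w_def q_def K_def N_def n_def)
  have qm: "(2 * q) *\<^sub>R m = w" by (simp add: w m_def add.commute)
  have ball': "\<forall>j\<in>A. norm (z j - m) \<le> r" using ball by (simp add: m_def r_def)
  note * = sqrt_sum_norm_le_ball[OF A m0 ball' P, folded n_def, unfolded rad q2 qm]
  show "sqrt (\<Sum>j\<in>A. (norm (z j))\<^sup>2)
      \<le> 1 / sqrt n * P + 1/4 * sqrt n * ((norm (b - a))\<^sup>2 / norm (b + a))"
    by (rule *(1))
  have "P = 2 * q * norm m \<longleftrightarrow> 0 \<le> K \<and> P = norm w"
  proof -
    have P0: "0 \<le> P" using P norm_ge_zero order_trans by blast
    have qK: "0 \<le> q \<longleftrightarrow> 0 \<le> K" using n N by (simp add: q_def zero_le_mult_iff zero_le_divide_iff)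
    have nw: "norm w = \<bar>q\<bar> * N" by (simp add: w N_def)
    have "2 * q * norm m = q * N" by (simp add: m)
    moreover have "0 \<le> q" if "P = q * N" using that P0 N by (simp add: zero_le_mult_iff)
    ultimately show ?thesis using qK nw by auto
  qed
  with *(2) show "sqrt (\<Sum>j\<in>A. (norm (z j))\<^sup>2)
        = 1 / sqrt n * P + 1/4 * sqrt n * ((norm (b - a))\<^sup>2 / norm (b + a)) \<longleftrightarrow>
      (\<forall>j\<in>A. norm (z j - (1/2) *\<^sub>R (a + b)) = 1/2 * norm (b - a)) \<and>
      0 \<le> (norm b)\<^sup>2 + 6 * inner b a + (norm a)\<^sup>2 \<and> (\<Sum>j\<in>A. z j) = w \<and> P = norm w"
    unfolding K_def m_def r_def by blast
qed

section \<open>The Cauchy-Schwarz inequality and its equality case\<close>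

lemma norm_residual_power2:
  fixes x v :: "'a::real_inner"
  assumes "x \<noteq> 0"
  shows "(norm (v - (inner x v / (norm x)\<^sup>2) *\<^sub>R x))\<^sup>2 * (norm x)\<^sup>2 = (norm x * norm v)\<^sup>2 - (inner x v)\<^sup>2"
proof -
  define t where "t = inner x v / (norm x)\<^sup>2"
  have t: "t * (norm x)\<^sup>2 = inner x v" using assms by (simp add: t_def)
  have "(norm (v - t *\<^sub>R x))\<^sup>2 = (norm v)\<^sup>2 - 2 * t * inner x v + t * (t * (norm x)\<^sup>2)"
    by (simp add: norm_diff_scaleR_power2 power2_eq_square[of t])
  also have "\<dots> = (norm v)\<^sup>2 - t * inner x v"
    by (simp add: t)
  finally have "(norm (v - t *\<^sub>R x))\<^sup>2 * (norm x)\<^sup>2 = ((norm v)\<^sup>2 - t * inner x v) * (norm x)\<^sup>2"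
    by simp
  also have "\<dots> = (norm x * norm v)\<^sup>2 - (t * (norm x)\<^sup>2) * inner x v"
    by (simp add: power_mult_distrib algebra_simps)
  finally have "(norm (v - t *\<^sub>R x))\<^sup>2 * (norm x)\<^sup>2 = (norm x * norm v)\<^sup>2 - (t * (norm x)\<^sup>2) * inner x v" .
  then show ?thesis
    by (simp add: t power2_eq_square[of "inner x v"] t_def[symmetric])
qed

text \<open>
  Prescribing the value of \<open>inner x v\<close> together with equality in the Cauchy-Schwarz inequality
  determines \<open>v\<close>; this turns the scalar conditions for equality into the formula for the mean.
\<close>

lemma inner_eq_and_cauchy_schwarz_eq_iff:
  fixes x v :: "'a::real_inner"
  assumes x: "x \<noteq> 0"
  shows "inner x v = w \<and> norm x * norm v = \<bar>w\<bar> \<longleftrightarrow> v = (w / (norm x)\<^sup>2) *\<^sub>R x"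
proof
  assume L: "inner x v = w \<and> norm x * norm v = \<bar>w\<bar>"
  then have "(norm (v - (w / (norm x)\<^sup>2) *\<^sub>R x))\<^sup>2 * (norm x)\<^sup>2 = 0"
    using norm_residual_power2[OF x, of v] by simp
  with x show "v = (w / (norm x)\<^sup>2) *\<^sub>R x" by simp
next
  assume "v = (w / (norm x)\<^sup>2) *\<^sub>R x"
  then show "inner x v = w \<and> norm x * norm v = \<bar>w\<bar>"
    using x by (simp add: power2_norm_eq_inner[symmetric] power2_eq_square)
qed

context complex_inner_product_space
begin

lemma ip_scale_right: "ip x (scale a y) = cnj a * ip x y"
  by (metis complex_cnj_mult ip_commute ip_scale_left)

lemma ip_add_right: "ip x (y + z) = ip x y + ip x z"
  by (metis complex_cnj_add ip_add_left ip_commute)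

lemma ip_zero_right: "ip x 0 = 0"
  using ip_add_right[of x 0 0] by simp

lemma ip_sum_right: "ip x (sum f A) = (\<Sum>j\<in>A. ip x (f j))"
  by (induction A rule: infinite_finite_induct) (simp_all add: ip_zero_right ip_add_right)

lemma ip_self: "ip x x = of_real ((ip_norm ip x)\<^sup>2)"
proof (rule complex_eqI)
  have "Im (ip x x) = - Im (ip x x)"
    by (metis cnj.sel(2) ip_commute)
  then show "Im (ip x x) = Im (of_real ((ip_norm ip x)\<^sup>2))" by simp
qed (simp add: ip_norm_def ip_ge_zero)

lemma ip_norm_nonneg: "0 \<le> ip_norm ip x"
  by (simp add: ip_norm_def ip_ge_zero)

lemma ip_norm_eq_0_iff: "ip_norm ip x = 0 \<longleftrightarrow> x = 0"
  using ip_self[of x] ip_eq_zero_iff[of x] by auto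

lemma ip_norm_scale: "ip_norm ip (scale a x) = cmod a * ip_norm ip x"
proof -
  have "of_real ((ip_norm ip (scale a x))\<^sup>2) = (a * cnj a) * ip x x"
    unfolding ip_self[symmetric] by (simp add: ip_scale_left ip_scale_right)
  also have "\<dots> = of_real ((cmod a * ip_norm ip x)\<^sup>2)"
    by (simp add: complex_norm_square[symmetric] ip_self power_mult_distrib)
  finally have "(ip_norm ip (scale a x))\<^sup>2 = (cmod a * ip_norm ip x)\<^sup>2"
    by (simp only: of_real_eq_iff)
  then show ?thesis
    by (simp add: power2_eq_iff_nonneg ip_norm_nonneg)
qed

lemma ip_norm_residual_power2:
  assumes "x \<noteq> 0"
  shows "(ip_norm ip (v + scale (- (cnj (ip x v) / of_real ((ip_norm ip x)\<^sup>2))) x))\<^sup>2 * (ip_norm ip x)\<^sup>2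
    = (ip_norm ip x * ip_norm ip v)\<^sup>2 - (cmod (ip x v))\<^sup>2"
proof -
  define X where "X = complex_of_real ((ip_norm ip x)\<^sup>2)"
  define p where "p = ip x v"
  have X: "X \<noteq> 0" "cnj X = X" "ip x x = X"
    using assms by (simp_all add: X_def ip_norm_eq_0_iff ip_self)
  have vx: "ip v x = cnj p" by (simp add: p_def ip_commute[symmetric])
  have "of_real ((ip_norm ip (v + scale (- (cnj p / X)) x))\<^sup>2) * X
      = (ip v v - (p / X) * cnj p - (cnj p / X) * (p - (p / X) * X)) * X"
    unfolding ip_self[symmetric]
    by (simp add: ip_add_left ip_add_right ip_scale_left ip_scale_right X vx p_def[symmetric]
        del: scale_minus_left add_uminus_conv_diff)
  also have "\<dots> = X * ip v v - p * cnj p"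
    using X(1) by (simp add: field_simps)
  also have "\<dots> = of_real ((ip_norm ip x * ip_norm ip v)\<^sup>2 - (cmod p)\<^sup>2)"
    by (simp add: X_def ip_self power_mult_distrib complex_norm_square del: of_real_power)
  finally show ?thesis
    unfolding X_def p_def of_real_mult[symmetric] of_real_eq_iff .
qed

lemma ip_cauchy_schwarz: "cmod (ip x v) \<le> ip_norm ip x * ip_norm ip v"
proof (cases "x = 0")
  case True
  then have "ip x v = 0" by (metis complex_cnj_zero ip_commute ip_zero_right)
  then show ?thesis by (simp add: ip_norm_nonneg)
next
  case False
  have "0 \<le> (ip_norm ip x * ip_norm ip v)\<^sup>2 - (cmod (ip x v))\<^sup>2"
    unfolding ip_norm_residual_power2[OF False, symmetric] by simp
  then have "(cmod (ip x v))\<^sup>2 \<le> (ip_norm ip x * ip_norm ip v)\<^sup>2" by simp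
  then show ?thesis by (rule power2_le_imp_le) (simp add: ip_norm_nonneg)
qed

text \<open>The complex counterpart of \<open>inner_eq_and_cauchy_schwarz_eq_iff\<close>; the conjugate appears
  because \<open>ip\<close> is conjugate-linear in the argument that is solved for.\<close>

lemma ip_eq_and_cauchy_schwarz_eq_iff:
  assumes x: "x \<noteq> 0"
  shows "ip x v = w \<and> ip_norm ip x * ip_norm ip v = cmod w
    \<longleftrightarrow> v = scale (cnj w / of_real ((ip_norm ip x)\<^sup>2)) x"
proof
  assume L: "ip x v = w \<and> ip_norm ip x * ip_norm ip v = cmod w"
  then have "(ip_norm ip (v + scale (- (cnj w / of_real ((ip_norm ip x)\<^sup>2))) x))\<^sup>2 * (ip_norm ip x)\<^sup>2 = 0"
    using ip_norm_residual_power2[OF x, of v] by simp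
  with x have "v + scale (- (cnj w / of_real ((ip_norm ip x)\<^sup>2))) x = 0"
    by (simp add: ip_norm_eq_0_iff)
  then show "v = scale (cnj w / of_real ((ip_norm ip x)\<^sup>2)) x"
    by (simp only: scale_minus_left add_uminus_conv_diff right_minus_eq)
next
  assume v: "v = scale (cnj w / of_real ((ip_norm ip x)\<^sup>2)) x"
  have n0: "ip_norm ip x \<noteq> 0" using x by (simp add: ip_norm_eq_0_iff)
  have "ip x v = w" using n0 by (simp add: v ip_scale_right ip_self)
  moreover have "ip_norm ip x * ip_norm ip v = cmod w"
    using n0 by (simp add: v ip_norm_scale norm_divide norm_mult ip_norm_nonneg power2_eq_square)
  ultimately show "ip x v = w \<and> ip_norm ip x * ip_norm ip v = cmod w" ..
qed

end

section \<open>The reverse inequality\<close>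

text \<open>
  In both fields the conditions \<open>Z = w\<close> and \<open>P = \<bar>w\<bar>\<close> of \<open>sqrt_sum_norm_eq_iff\<close>, with \<open>Z = \<langle>x, \<Sum>j. y j\<rangle>\<close>
  and \<open>P = \<parallel>x\<parallel> * \<parallel>\<Sum>j. y j\<parallel>\<close>, are exchanged for the formula for the mean of the \<open>y j\<close> by the
  equality case of the Cauchy-Schwarz inequality.
\<close>

lemma
  fixes a b :: real and x :: "'a::real_inner" and y :: "nat \<Rightarrow> 'a"
  assumes n: "n \<ge> 1" and ba: "b \<noteq> - a"
    and ball: "\<forall>j\<in>{1..n}. \<bar>inner x (y j) - (a + b) / 2\<bar> \<le> 1 / 2 * \<bar>b - a\<bar>"
  shows sqrt_sum_inner_le: "sqrt (\<Sum>j=1..n. \<bar>inner x (y j)\<bar>\<^sup>2)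
      \<le> 1 / sqrt (real n) * norm x * norm (\<Sum>j=1..n. y j)
         + 1 / 4 * sqrt (real n) * (\<bar>b - a\<bar>\<^sup>2 / \<bar>b + a\<bar>)"
    and sqrt_sum_inner_eq_iff: "x \<noteq> 0 \<Longrightarrow>
      sqrt (\<Sum>j=1..n. \<bar>inner x (y j)\<bar>\<^sup>2)
        = 1 / sqrt (real n) * norm x * norm (\<Sum>j=1..n. y j)
           + 1 / 4 * sqrt (real n) * (\<bar>b - a\<bar>\<^sup>2 / \<bar>b + a\<bar>) \<longleftrightarrow>
      (\<forall>j\<in>{1..n}. \<bar>inner x (y j) - (a + b) / 2\<bar> = 1 / 2 * \<bar>b - a\<bar>) \<and>
      (1 / real n) *\<^sub>R (\<Sum>j=1..n. y j)
        = (1 / 4 * ((\<bar>b\<bar>\<^sup>2 + 6 * (b * a) + \<bar>a\<bar>\<^sup>2) / ((b + a) * (norm x)\<^sup>2))) *\<^sub>R x \<and>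
      0 \<le> \<bar>b\<bar>\<^sup>2 + 6 * (b * a) + \<bar>a\<bar>\<^sup>2"
proof -
  define Y where "Y = (\<Sum>j=1..n. y j)"
  define K where "K = \<bar>b\<bar>\<^sup>2 + 6 * (b * a) + \<bar>a\<bar>\<^sup>2"
  define w where "w = (real n * (K / (4 * \<bar>b + a\<bar>\<^sup>2))) *\<^sub>R (b + a)"
  have A: "finite {1..n}" "{1..n} \<noteq> {}" using n by simp_all
  have Z: "(\<Sum>j=1..n. inner x (y j)) = inner x Y" by (simp add: Y_def inner_sum_right)
  have mid: "(1/2) *\<^sub>R (a + b) = (a + b) / 2" by simp
  have K: "\<bar>b\<bar>\<^sup>2 + 6 * inner b a + \<bar>a\<bar>\<^sup>2 = K" by (simp add: K_def)
  have ball': "\<forall>j\<in>{1..n}. norm (inner x (y j) - (1/2) *\<^sub>R (a + b)) \<le> 1/2 * norm (b - a)"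
    using ball by simp
  have P: "norm (\<Sum>j=1..n. inner x (y j)) \<le> norm x * norm Y"
    by (simp only: Z real_norm_def Cauchy_Schwarz_ineq2)
  show "sqrt (\<Sum>j=1..n. \<bar>inner x (y j)\<bar>\<^sup>2)
      \<le> 1 / sqrt (real n) * norm x * norm (\<Sum>j=1..n. y j)
         + 1 / 4 * sqrt (real n) * (\<bar>b - a\<bar>\<^sup>2 / \<bar>b + a\<bar>)"
    using sqrt_sum_norm_le[OF A ba ball' P] by (simp add: Y_def mult.assoc)
  assume x: "x \<noteq> 0"
  have ba0: "b + a \<noteq> 0" using ba by auto
  have mean: "inner x Y = w \<and> norm x * norm Y = \<bar>w\<bar>
      \<longleftrightarrow> (1 / real n) *\<^sub>R Y = (1 / 4 * (K / ((b + a) * (norm x)\<^sup>2))) *\<^sub>R x"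
  proof -
    have "w / (norm x)\<^sup>2 = real n * (1 / 4 * (K / ((b + a) * (norm x)\<^sup>2)))"
      using ba0 by (simp add: w_def power2_eq_square)
    then have "Y = (w / (norm x)\<^sup>2) *\<^sub>R x
        \<longleftrightarrow> Y = real n *\<^sub>R (1 / 4 * (K / ((b + a) * (norm x)\<^sup>2))) *\<^sub>R x"
      by (simp only: scaleR_scaleR)
    also have "\<dots> \<longleftrightarrow> (1 / real n) *\<^sub>R Y = (1 / 4 * (K / ((b + a) * (norm x)\<^sup>2))) *\<^sub>R x"
      (is "Y = _ *\<^sub>R ?v \<longleftrightarrow> _")
    proof
      assume "Y = real n *\<^sub>R ?v"
      then show "(1 / real n) *\<^sub>R Y = ?v" using n by (simp only: scaleR_scaleR) simp
    next
      assume "(1 / real n) *\<^sub>R Y = ?v"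
      from this[symmetric] show "Y = real n *\<^sub>R ?v" using n by (simp only: scaleR_scaleR) simp
    qed
    finally show ?thesis using inner_eq_and_cauchy_schwarz_eq_iff[OF x, of Y w] by simp
  qed
  have "sqrt (\<Sum>j=1..n. \<bar>inner x (y j)\<bar>\<^sup>2)
        = 1 / sqrt (real n) * norm x * norm (\<Sum>j=1..n. y j)
           + 1 / 4 * sqrt (real n) * (\<bar>b - a\<bar>\<^sup>2 / \<bar>b + a\<bar>) \<longleftrightarrow>
      (\<forall>j\<in>{1..n}. \<bar>inner x (y j) - (a + b) / 2\<bar> = 1 / 2 * \<bar>b - a\<bar>) \<and>
      0 \<le> K \<and> inner x Y = w \<and> norm x * norm Y = \<bar>w\<bar>"
    using sqrt_sum_norm_eq_iff[OF A ba ball' P]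
    by (simp only: Z mid K real_norm_def card_atLeastAtMost diff_Suc_1 Y_def[symmetric] w_def[symmetric] mult.assoc)
  then show "sqrt (\<Sum>j=1..n. \<bar>inner x (y j)\<bar>\<^sup>2)
        = 1 / sqrt (real n) * norm x * norm (\<Sum>j=1..n. y j)
           + 1 / 4 * sqrt (real n) * (\<bar>b - a\<bar>\<^sup>2 / \<bar>b + a\<bar>) \<longleftrightarrow>
      (\<forall>j\<in>{1..n}. \<bar>inner x (y j) - (a + b) / 2\<bar> = 1 / 2 * \<bar>b - a\<bar>) \<and>
      (1 / real n) *\<^sub>R (\<Sum>j=1..n. y j)
        = (1 / 4 * ((\<bar>b\<bar>\<^sup>2 + 6 * (b * a) + \<bar>a\<bar>\<^sup>2) / ((b + a) * (norm x)\<^sup>2))) *\<^sub>R x \<and>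
      0 \<le> \<bar>b\<bar>\<^sup>2 + 6 * (b * a) + \<bar>a\<bar>\<^sup>2"
    unfolding K_def[symmetric] Y_def[symmetric] mean[symmetric] by blast
qed

lemma (in complex_inner_product_space)
  fixes a b :: complex
  assumes n: "n \<ge> 1" and ba: "b \<noteq> - a"
    and ball: "\<forall>j\<in>{1..n}. cmod (ip x (y j) - (a + b) / 2) \<le> 1 / 2 * cmod (b - a)"
  shows sqrt_sum_ip_le: "sqrt (\<Sum>j=1..n. (cmod (ip x (y j)))\<^sup>2)
      \<le> 1 / sqrt (real n) * ip_norm ip x * ip_norm ip (\<Sum>j=1..n. y j)
         + 1 / 4 * sqrt (real n) * ((cmod (b - a))\<^sup>2 / cmod (b + a))"
    and sqrt_sum_ip_eq_iff: "x \<noteq> 0 \<Longrightarrow>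
      sqrt (\<Sum>j=1..n. (cmod (ip x (y j)))\<^sup>2)
        = 1 / sqrt (real n) * ip_norm ip x * ip_norm ip (\<Sum>j=1..n. y j)
           + 1 / 4 * sqrt (real n) * ((cmod (b - a))\<^sup>2 / cmod (b + a)) \<longleftrightarrow>
      (\<forall>j\<in>{1..n}. cmod (ip x (y j) - (a + b) / 2) = 1 / 2 * cmod (b - a)) \<and>
      scale (1 / of_nat n) (\<Sum>j=1..n. y j)
        = scale (1 / 4 * (of_real ((cmod b)\<^sup>2 + 6 * Re (b * cnj a) + (cmod a)\<^sup>2)
            / ((b + a) * of_real ((ip_norm ip x)\<^sup>2)))) x \<and>
      0 \<le> (cmod b)\<^sup>2 + 6 * Re (b * cnj a) + (cmod a)\<^sup>2"
proof -
  define Y where "Y = (\<Sum>j=1..n. y j)"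
  define K where "K = (cmod b)\<^sup>2 + 6 * Re (b * cnj a) + (cmod a)\<^sup>2"
  define w where "w = (real n * (K / (4 * (cmod (b + a))\<^sup>2))) *\<^sub>R (b + a)"
  have A: "finite {1..n}" "{1..n} \<noteq> {}" using n by simp_all
  have Z: "(\<Sum>j=1..n. ip x (y j)) = ip x Y" by (simp add: Y_def ip_sum_right)
  have mid: "(1/2) *\<^sub>R (a + b) = (a + b) / 2" by (simp add: scaleR_conv_of_real)
  have ball': "\<forall>j\<in>{1..n}. norm (ip x (y j) - (1/2) *\<^sub>R (a + b)) \<le> 1/2 * norm (b - a)"
    using ball unfolding mid by simp
  have P: "norm (\<Sum>j=1..n. ip x (y j)) \<le> ip_norm ip x * ip_norm ip Y"
    by (simp only: Z ip_cauchy_schwarz)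
  have K: "(cmod b)\<^sup>2 + 6 * inner b a + (cmod a)\<^sup>2 = K"
    by (simp add: K_def inner_complex_def)
  show "sqrt (\<Sum>j=1..n. (cmod (ip x (y j)))\<^sup>2)
      \<le> 1 / sqrt (real n) * ip_norm ip x * ip_norm ip (\<Sum>j=1..n. y j)
         + 1 / 4 * sqrt (real n) * ((cmod (b - a))\<^sup>2 / cmod (b + a))"
    using sqrt_sum_norm_le[OF A ba ball' P] by (simp add: Y_def mult.assoc)
  assume x: "x \<noteq> 0"
  have ba0: "b + a \<noteq> 0" using ba by (simp add: eq_neg_iff_add_eq_0)
  have mean: "ip x Y = w \<and> ip_norm ip x * ip_norm ip Y = cmod w
      \<longleftrightarrow> scale (1 / of_nat n) Y = scale (1 / 4 * (of_real K / ((b + a) * of_real ((ip_norm ip x)\<^sup>2)))) x"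
  proof -
    \<comment> \<open>Conjugation moves \<open>b + a\<close> into the denominator: \<open>cnj s / \<bar>s\<bar>\<^sup>2 = 1 / s\<close>.\<close>
    have "cnj w = of_nat n * (of_real K / (4 * (b + a)))"
    proof -
      have "cnj w = of_nat n * (of_real K / (4 * of_real ((cmod (b + a))\<^sup>2))) * cnj (b + a)"
        by (simp add: w_def scaleR_conv_of_real)
      also have "\<dots> = of_nat n * (of_real K / (4 * (b + a)))"
        unfolding complex_norm_square using ba0
        by (simp del: complex_cnj_add add: complex_cnj_zero_iff)
      finally show ?thesis .
    qed
    then have "cnj w / of_real ((ip_norm ip x)\<^sup>2)
        = of_nat n * (1 / 4 * (of_real K / ((b + a) * of_real ((ip_norm ip x)\<^sup>2))))"
      by simp
    then have "Y = scale (cnj w / of_real ((ip_norm ip x)\<^sup>2)) x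
        \<longleftrightarrow> Y = scale (of_nat n) (scale (1 / 4 * (of_real K / ((b + a) * of_real ((ip_norm ip x)\<^sup>2)))) x)"
      by (simp only: scale_scale)
    also have "\<dots> \<longleftrightarrow> scale (1 / of_nat n) Y
        = scale (1 / 4 * (of_real K / ((b + a) * of_real ((ip_norm ip x)\<^sup>2)))) x" (is "Y = scale _ ?v \<longleftrightarrow> _")
    proof
      assume "Y = scale (of_nat n) ?v"
      then show "scale (1 / of_nat n) Y = ?v" using n by (simp only: scale_scale) simp
    next
      assume "scale (1 / of_nat n) Y = ?v"
      from this[symmetric] show "Y = scale (of_nat n) ?v" using n by (simp only: scale_scale) simp
    qed
    finally show ?thesis using ip_eq_and_cauchy_schwarz_eq_iff[OF x, of Y w] by simp
  qed
  have "sqrt (\<Sum>j=1..n. (cmod (ip x (y j)))\<^sup>2)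
        = 1 / sqrt (real n) * ip_norm ip x * ip_norm ip (\<Sum>j=1..n. y j)
           + 1 / 4 * sqrt (real n) * ((cmod (b - a))\<^sup>2 / cmod (b + a)) \<longleftrightarrow>
      (\<forall>j\<in>{1..n}. cmod (ip x (y j) - (a + b) / 2) = 1 / 2 * cmod (b - a)) \<and>
      0 \<le> K \<and> ip x Y = w \<and> ip_norm ip x * ip_norm ip Y = cmod w"
    using sqrt_sum_norm_eq_iff[OF A ba ball' P]
    by (simp only: Z mid K card_atLeastAtMost diff_Suc_1 Y_def[symmetric] w_def[symmetric] mult.assoc)
  then show "sqrt (\<Sum>j=1..n. (cmod (ip x (y j)))\<^sup>2)
        = 1 / sqrt (real n) * ip_norm ip x * ip_norm ip (\<Sum>j=1..n. y j)
           + 1 / 4 * sqrt (real n) * ((cmod (b - a))\<^sup>2 / cmod (b + a)) \<longleftrightarrow>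
      (\<forall>j\<in>{1..n}. cmod (ip x (y j) - (a + b) / 2) = 1 / 2 * cmod (b - a)) \<and>
      scale (1 / of_nat n) (\<Sum>j=1..n. y j)
        = scale (1 / 4 * (of_real ((cmod b)\<^sup>2 + 6 * Re (b * cnj a) + (cmod a)\<^sup>2)
            / ((b + a) * of_real ((ip_norm ip x)\<^sup>2)))) x \<and>
      0 \<le> (cmod b)\<^sup>2 + 6 * Re (b * cnj a) + (cmod a)\<^sup>2"
    unfolding K_def[symmetric] Y_def[symmetric] mean[symmetric] by blast
qed

theorem theorem9:
  fixes n :: nat
    and \<gamma>\<^sub>R \<Gamma>\<^sub>R :: real
    and x\<^sub>R :: "'a::real_inner"
    and y\<^sub>R :: "nat \<Rightarrow> 'a"
    and \<gamma> \<Gamma> :: complex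
    and scale :: "complex \<Rightarrow> 'h::ab_group_add \<Rightarrow> 'h"
    and ip :: "'h \<Rightarrow> 'h \<Rightarrow> complex"
    and x :: 'h
    and y :: "nat \<Rightarrow> 'h"
  assumes "n \<ge> 1"
  shows
    "(\<Gamma>\<^sub>R \<noteq> - \<gamma>\<^sub>R \<longrightarrow>
        (\<forall>j\<in>{1..n}.
           (\<Gamma>\<^sub>R - inner x\<^sub>R (y\<^sub>R j)) * (inner x\<^sub>R (y\<^sub>R j) - \<gamma>\<^sub>R) \<ge> 0 \<longleftrightarrow>
           \<bar>inner x\<^sub>R (y\<^sub>R j) - (\<gamma>\<^sub>R + \<Gamma>\<^sub>R) / 2\<bar> \<le> 1 / 2 * \<bar>\<Gamma>\<^sub>R - \<gamma>\<^sub>R\<bar>) \<and>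
        ((\<forall>j\<in>{1..n}. (\<Gamma>\<^sub>R - inner x\<^sub>R (y\<^sub>R j)) * (inner x\<^sub>R (y\<^sub>R j) - \<gamma>\<^sub>R) \<ge> 0) \<longrightarrow>
           sqrt (\<Sum>j=1..n. \<bar>inner x\<^sub>R (y\<^sub>R j)\<bar>\<^sup>2)
             \<le> 1 / sqrt (real n) * norm x\<^sub>R * norm (\<Sum>j=1..n. y\<^sub>R j)
                + 1 / 4 * sqrt (real n) * (\<bar>\<Gamma>\<^sub>R - \<gamma>\<^sub>R\<bar>\<^sup>2 / \<bar>\<Gamma>\<^sub>R + \<gamma>\<^sub>R\<bar>) \<and>
           (x\<^sub>R \<noteq> 0 \<longrightarrow>
              (sqrt (\<Sum>j=1..n. \<bar>inner x\<^sub>R (y\<^sub>R j)\<bar>\<^sup>2)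
                 = 1 / sqrt (real n) * norm x\<^sub>R * norm (\<Sum>j=1..n. y\<^sub>R j)
                    + 1 / 4 * sqrt (real n) * (\<bar>\<Gamma>\<^sub>R - \<gamma>\<^sub>R\<bar>\<^sup>2 / \<bar>\<Gamma>\<^sub>R + \<gamma>\<^sub>R\<bar>) \<longleftrightarrow>
               (\<forall>j\<in>{1..n}. \<bar>inner x\<^sub>R (y\<^sub>R j) - (\<gamma>\<^sub>R + \<Gamma>\<^sub>R) / 2\<bar> = 1 / 2 * \<bar>\<Gamma>\<^sub>R - \<gamma>\<^sub>R\<bar>) \<and>
               (1 / real n) *\<^sub>R (\<Sum>j=1..n. y\<^sub>R j)
                 = (1 / 4 * ((\<bar>\<Gamma>\<^sub>R\<bar>\<^sup>2 + 6 * (\<Gamma>\<^sub>R * \<gamma>\<^sub>R) + \<bar>\<gamma>\<^sub>R\<bar>\<^sup>2)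
                      / ((\<Gamma>\<^sub>R + \<gamma>\<^sub>R) * (norm x\<^sub>R)\<^sup>2))) *\<^sub>R x\<^sub>R \<and>
               0 \<le> \<bar>\<Gamma>\<^sub>R\<bar>\<^sup>2 + 6 * (\<Gamma>\<^sub>R * \<gamma>\<^sub>R) + \<bar>\<gamma>\<^sub>R\<bar>\<^sup>2)))) \<and>
     (complex_inner_product_space scale ip \<and> \<Gamma> \<noteq> - \<gamma> \<longrightarrow>
        (\<forall>j\<in>{1..n}.
           (Re \<Gamma> - Re (ip x (y j))) * (Re (ip x (y j)) - Re \<gamma>)
             + (Im \<Gamma> - Im (ip x (y j))) * (Im (ip x (y j)) - Im \<gamma>) \<ge> 0 \<longleftrightarrow>
           cmod (ip x (y j) - (\<gamma> + \<Gamma>) / 2) \<le> 1 / 2 * cmod (\<Gamma> - \<gamma>)) \<and>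
        ((\<forall>j\<in>{1..n}.
            (Re \<Gamma> - Re (ip x (y j))) * (Re (ip x (y j)) - Re \<gamma>)
              + (Im \<Gamma> - Im (ip x (y j))) * (Im (ip x (y j)) - Im \<gamma>) \<ge> 0) \<longrightarrow>
           sqrt (\<Sum>j=1..n. (cmod (ip x (y j)))\<^sup>2)
             \<le> 1 / sqrt (real n) * ip_norm ip x * ip_norm ip (\<Sum>j=1..n. y j)
                + 1 / 4 * sqrt (real n) * ((cmod (\<Gamma> - \<gamma>))\<^sup>2 / cmod (\<Gamma> + \<gamma>)) \<and>
           (x \<noteq> 0 \<longrightarrow>
              (sqrt (\<Sum>j=1..n. (cmod (ip x (y j)))\<^sup>2)
                 = 1 / sqrt (real n) * ip_norm ip x * ip_norm ip (\<Sum>j=1..n. y j)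
                    + 1 / 4 * sqrt (real n) * ((cmod (\<Gamma> - \<gamma>))\<^sup>2 / cmod (\<Gamma> + \<gamma>)) \<longleftrightarrow>
               (\<forall>j\<in>{1..n}. cmod (ip x (y j) - (\<gamma> + \<Gamma>) / 2) = 1 / 2 * cmod (\<Gamma> - \<gamma>)) \<and>
               scale (1 / of_nat n) (\<Sum>j=1..n. y j)
                 = scale (1 / 4 * (of_real ((cmod \<Gamma>)\<^sup>2 + 6 * Re (\<Gamma> * cnj \<gamma>) + (cmod \<gamma>)\<^sup>2)
                            / ((\<Gamma> + \<gamma>) * of_real ((ip_norm ip x)\<^sup>2)))) x \<and>
               0 \<le> (cmod \<Gamma>)\<^sup>2 + 6 * Re (\<Gamma> * cnj \<gamma>) + (cmod \<gamma>)\<^sup>2))))"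
  (is "(_ \<longrightarrow> ?RE \<and> (?RH \<longrightarrow> ?RI \<and> (_ \<longrightarrow> ?RQ))) \<and>
       (_ \<longrightarrow> ?CE \<and> (?CH \<longrightarrow> ?CI \<and> (_ \<longrightarrow> ?CQ)))")
proof (intro conjI[of "_ \<longrightarrow> _" "_ \<longrightarrow> _"] impI)
  assume G: "\<Gamma>\<^sub>R \<noteq> - \<gamma>\<^sub>R"
  have E: ?RE
    using in_ball_of_diameter_iff[where 'a = real and a = \<gamma>\<^sub>R and b = \<Gamma>\<^sub>R] by simp
  moreover have "?RI \<and> (x\<^sub>R \<noteq> 0 \<longrightarrow> ?RQ)" if ?RH
  proof -
    have ball: "\<forall>j\<in>{1..n}. \<bar>inner x\<^sub>R (y\<^sub>R j) - (\<gamma>\<^sub>R + \<Gamma>\<^sub>R) / 2\<bar> \<le> 1 / 2 * \<bar>\<Gamma>\<^sub>R - \<gamma>\<^sub>R\<bar>"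
      using E that by blast
    show ?thesis
      using sqrt_sum_inner_le[OF assms G ball] sqrt_sum_inner_eq_iff[OF assms G ball] by blast
  qed
  ultimately show "?RE \<and> (?RH \<longrightarrow> ?RI \<and> (x\<^sub>R \<noteq> 0 \<longrightarrow> ?RQ))" by blast
next
  assume "complex_inner_product_space scale ip \<and> \<Gamma> \<noteq> - \<gamma>"
  then interpret complex_inner_product_space scale ip by blast
  from \<open>complex_inner_product_space scale ip \<and> \<Gamma> \<noteq> - \<gamma>\<close> have G: "\<Gamma> \<noteq> - \<gamma>" ..
  have mid: "(1/2) *\<^sub>R (\<gamma> + \<Gamma>) = (\<gamma> + \<Gamma>) / 2" by (simp add: scaleR_conv_of_real)
  have E: ?CE
    using in_ball_of_diameter_iff[where 'a = complex and a = \<gamma> and b = \<Gamma>, unfolded mid inner_complex_def]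
    by simp
  moreover have "?CI \<and> (x \<noteq> 0 \<longrightarrow> ?CQ)" if ?CH
  proof -
    have ball: "\<forall>j\<in>{1..n}. cmod (ip x (y j) - (\<gamma> + \<Gamma>) / 2) \<le> 1 / 2 * cmod (\<Gamma> - \<gamma>)"
      using E that by blast
    show ?thesis
      using sqrt_sum_ip_le[OF assms G ball] sqrt_sum_ip_eq_iff[OF assms G ball] by blast
  qed
  ultimately show "?CE \<and> (?CH \<longrightarrow> ?CI \<and> (x \<noteq> 0 \<longrightarrow> ?CQ))" by blast
qed

end
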